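(* Let $q$ be an odd prime power and let $\gamma\in\mathbb{F}_{q^2}$. The polynomial $f(x)=x+\gamma\,\mathrm{Tr}(x^2)$ over $\mathbb{F}_{q^2}$ is a permutation polynomial if and only if $\gamma=0$. Consequently, for $H(x)=x^2$ the set $P_H=\{\gamma\in\mathbb{F}_{q^2}: x+\gamma\,\mathrm{Tr}(H(x))\text{ is a permutation polynomial over }\mathbb{F}_{q^2}\}$ equals $\{0\}$.
   Context: $\mathrm{Tr}:\mathbb{F}_{q^2}\to\mathbb{F}_q$ is the trace map $\mathrm{Tr}(x)=x+x^q$. A polynomial $f$ over $\mathbb{F}_{q^2}$ is a permutation polynomial if the map $x\mapsto f(x)$ is a bijection of $\mathbb{F}_{q^2}$ onto itself. *)

theory Defs
  imports "HOL-Computational_Algebra.Polynomial" "HOL-Number_Theory.Prime_Powers"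
    "HOL-Library.Cardinality"
begin

(* The field with q^2 elements is any type 'a :: {field, finite} with CARD('a) = q^2; its
   subfield with q elements is {x. x ^ q = x}, into which the trace maps. *)

definition Tr :: "nat \<Rightarrow> 'a::field \<Rightarrow> 'a" where
  "Tr q x = x + x ^ q"

definition permutation_poly :: "'a::field poly \<Rightarrow> bool" where
  "permutation_poly f \<longleftrightarrow> bij (poly f)"

(* The formal polynomial x + \<gamma> Tr(H(x)), with Tr(H(x)) = H + H^q; see poly_trace_poly. *)
definition trace_poly :: "nat \<Rightarrow> 'a::field poly \<Rightarrow> 'a \<Rightarrow> 'a poly" where
  "trace_poly q H \<gamma> = monom 1 1 + smult \<gamma> (H + H ^ q)"

lemma poly_trace_poly: "poly (trace_poly q H \<gamma>) x = x + \<gamma> * Tr q (poly H x)"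
  by (simp add: trace_poly_def Tr_def poly_monom)

definition P_set :: "nat \<Rightarrow> 'a::field poly \<Rightarrow> 'a set" where
  "P_set q H = {\<gamma>. permutation_poly (trace_poly q H \<gamma>)}"

end

theory Submission
  imports Defs
begin

text \<open>
  For \<open>\<gamma> \<noteq> 0\<close> put \<open>u = - 1 / (2 \<gamma>)\<close>. The distinct points \<open>x = (u + \<gamma>) / 2\<close> and
  \<open>y = (u - \<gamma>) / 2\<close> satisfy \<open>x - y = \<gamma>\<close> and \<open>x\<^sup>2 - y\<^sup>2 = u \<gamma> = - 1 / 2\<close>, which lies in the
  prime field and so has trace \<open>- 1\<close>; by additivity of the trace, the two points have the
  same image.
\<close>

text \<open>Translation by 1 permutes the field, so comparing the sums of all elements before and
  after it gives \<open>of_nat CARD('a) = 0\<close>. Hence the prime characteristic divides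
  \<open>p ^ n\<close>.\<close>

lemma CHAR_eq_prime_of_CARD_eq_power:
  assumes "prime p" and "CARD('a::{field,finite}) = p ^ n"
  shows "CHAR('a) = p"
proof -
  have prime: "prime CHAR('a)"
    by (simp add: finite_imp_CHAR_pos prime_CHAR_semidom)
  have "(\<Sum>x\<in>UNIV. x + 1) = (\<Sum>x\<in>UNIV. x :: 'a)"
    by (rule sum.reindex_bij_betw[where g = "\<lambda>x. x"]) (rule bij_plus_right)
  then have "of_nat CARD('a) = (0 :: 'a)"
    by (simp add: sum.distrib)
  then have "CHAR('a) dvd p ^ n"
    unfolding of_nat_eq_0_iff_char_dvd assms(2) .
  with prime assms(1) show ?thesis
    using prime_dvd_power primes_dvd_imp_eq by blast
qed

theorem theorem3p2:
  fixes q :: nat and \<gamma> :: "'a::{field,finite}"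
  assumes "primepow q" and "odd q" and "CARD('a) = q ^ 2"
  shows "(permutation_poly (trace_poly q (monom 1 2) \<gamma>) \<longleftrightarrow> \<gamma> = 0) \<and>
    P_set q (monom 1 2 :: 'a poly) = {0}"
proof -
  obtain p k where pk: "prime p" "k > 0" "q = p ^ k"
    using assms(1) by (auto simp: primepow_def)
  have "CARD('a) = p ^ (k * 2)"
    by (simp add: assms(3) pk(3) power_mult)
  then have char: "CHAR('a) = p"
    by (rule CHAR_eq_prime_of_CARD_eq_power[OF pk(1)])
  have frob: "(a + b) ^ q = a ^ q + b ^ q" for a b :: 'a
    by (rule freshmans_dream') (simp_all add: pk char)
  have "p \<noteq> 2"
    using assms(2) pk by auto
  then have "\<not> p dvd 2"
    using pk(1) primes_dvd_imp_eq two_is_prime_nat by blast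
  then have two: "(2 :: 'a) \<noteq> 0"
    using of_nat_eq_0_iff_char_dvd[of 2, where 'a = 'a] char by simp
  \<comment> \<open>As \<open>2 = 1 + 1\<close>, additivity of the \<open>q\<close>-th power map
    fixes 2, hence also \<open>1 / 2\<close>; the trace of \<open>1 / 2\<close> is therefore
    1.\<close>
  have two_q: "(2 :: 'a) ^ q = 2"
    using frob[of 1 1] by simp
  have perm_iff: "permutation_poly (trace_poly q (monom 1 2) c) \<longleftrightarrow> c = 0" for c :: 'a
  proof
    assume perm: "permutation_poly (trace_poly q (monom 1 2) c)"
    show "c = 0"
    proof (rule ccontr)
      assume c: "c \<noteq> 0"
      define u where "u = - 1 / (2 * c)"
      define x where "x = (u + c) / 2"
      define y where "y = (u - c) / 2"
      have diff: "x = y + c"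
        using two by (simp add: x_def y_def field_simps)
      have "u * c = - 1 / 2"
        using c two by (simp add: u_def)
      moreover have "x + y = u"
        using two by (simp add: x_def y_def flip: add_divide_distrib mult_2)
      then have "u * c = x\<^sup>2 - y\<^sup>2"
        using diff by (simp add: power2_eq_square algebra_simps flip: \<open>x + y = u\<close>)
      ultimately have "y\<^sup>2 = x\<^sup>2 + 1 / 2"
        by (simp add: algebra_simps)
      then have "Tr q (y\<^sup>2) = Tr q (x\<^sup>2) + 1"
        using two by (simp add: Tr_def frob power_divide two_q)
      \<comment> \<open>Passing from \<open>y\<close> to \<open>x\<close> adds \<open>c\<close> to
        the linear term, while the trace drops by 1 and so removes \<open>c\<close> from the other
        term.\<close>
      then have "poly (trace_poly q (monom 1 2) c) x = poly (trace_poly q (monom 1 2) c) y"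
        by (simp add: poly_trace_poly poly_monom diff algebra_simps)
      with perm have "x = y"
        by (auto simp: permutation_poly_def bij_def dest: injD)
      with diff c show False
        by simp
    qed
  next
    assume "c = 0"
    then have "poly (trace_poly q (monom 1 2) c) = id"
      by (auto simp: poly_trace_poly)
    then show "permutation_poly (trace_poly q (monom 1 2) c)"
      by (simp add: permutation_poly_def)
  qed
  then show ?thesis
    by (auto simp: P_set_def)
qed

end
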